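(* Any algorithm for the explicit vertex stream model which finds a $c$-approximation to the size $\omega(G)$ of the largest clique of the input graph $G$ with probability at least $2/3$ requires $\Omega\left(\frac{n^2}{c^7}\right)$ space, where $n$ is the number of vertices of $G$.
   Context: In an explicit vertex stream, the vertices $v_1,\dots,v_n$ of a graph $G$ arrive one at a time in arbitrary order, and each vertex $v_i$ arrives together with the list of all its edges to previously arrived vertices $v_j$, $j<i$; the stream is read once. A $c$-approximation to $\omega(G)$ is a value $\gamma$ with $\frac{1}{c}\omega(G)\le\gamma\le\omega(G)$.
   Formalization: The bound is stated for 1 ≤ c < n; for c ≥ n it fails literally, since an algorithm with no memory that always outputs 1 is already a c-approximation using 0 bits. *)

theory Defs
  imports "HOL-Probability.Probability_Mass_Function" "HOL-Library.Ramsey"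
begin

text \<open>A graph on \<open>n\<close> vertices has vertex set \<open>{..<n}\<close> and edge set
  \<open>E \<subseteq> nsets {..<n} 2\<close>.\<close>

definition clique_number :: "nat \<Rightarrow> nat set set \<Rightarrow> nat" where
  "clique_number n E = Max (card ` {C. C \<subseteq> {..<n} \<and> clique C E})"

definition is_approximation :: "real \<Rightarrow> real \<Rightarrow> real \<Rightarrow> bool" where
  "is_approximation c w \<gamma> \<longleftrightarrow> 1 / c * w \<le> \<gamma> \<and> \<gamma> \<le> w"

text \<open>A stream item is a vertex together with its edges to the vertices that arrived before it.
  These edges are given as a set, so an algorithm that reads them from a list in some order is
  covered by fixing that order.\<close>

type_synonym item = "nat \<times> nat set set"

definition vertex_stream :: "nat set set \<Rightarrow> nat list \<Rightarrow> item list" where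
  "vertex_stream E vs =
     map (\<lambda>i. (vs ! i, {{vs ! i, vs ! j} | j. j < i \<and> {vs ! i, vs ! j} \<in> E})) [0..<length vs]"

definition vertex_streams :: "nat \<Rightarrow> (nat set set \<times> item list) set" where
  "vertex_streams n =
     {(E, vertex_stream E vs) | E vs. E \<subseteq> nsets {..<n} 2 \<and> distinct vs \<and> set vs = {..<n}}"

text \<open>The memory contents between two items are a bit string; the computation performed on a
  single item is unrestricted.\<close>

record stream_alg =
  init :: "bool list"
  update :: "bool list \<Rightarrow> item \<Rightarrow> bool list"
  result :: "bool list \<Rightarrow> real"

definition memory_after :: "stream_alg \<Rightarrow> item list \<Rightarrow> bool list" where
  "memory_after a xs = foldl (update a) (init a) xs"

definition answer :: "stream_alg \<Rightarrow> item list \<Rightarrow> real" where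
  "answer a xs = result a (memory_after a xs)"

text \<open>A randomized algorithm is a distribution over deterministic ones, so random bits are not
  charged as space. Algorithms that toss fresh coins at every item are a special case: no vertex
  arrives twice, so \<^const>\<open>update\<close> is never applied twice to the same item in one run.\<close>

type_synonym random_stream_alg = "stream_alg pmf"

definition approximates_clique_number :: "nat \<Rightarrow> real \<Rightarrow> random_stream_alg \<Rightarrow> bool" where
  "approximates_clique_number n c A \<longleftrightarrow>
     (\<forall>(E, xs) \<in> vertex_streams n.
        measure_pmf.prob A {a. is_approximation c (real (clique_number n E)) (answer a xs)} \<ge> 2 / 3)"

text \<open>At most \<open>s\<close> bits are stored at any time, for every input and every outcome of the coins.\<close>

definition uses_space :: "nat \<Rightarrow> nat \<Rightarrow> random_stream_alg \<Rightarrow> bool" where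
  "uses_space n s A \<longleftrightarrow>
     (\<forall>a \<in> set_pmf A. \<forall>(E, xs) \<in> vertex_streams n. \<forall>i \<le> n.
        length (memory_after a (take i xs)) \<le> s)"

end

theory Submission
  imports Defs
begin

text \<open>
  The lower bound comes from a chain of \<open>k \<approx> 2c\<close> instances of the INDEX problem that all have the
  same answer. Player \<open>i\<close> owns a \<open>k\<close> by \<open>q\<close> grid of vertices and a set \<open>X\<^sub>i\<close> of lines of the grid;
  two of the vertices are adjacent iff they lie on a common line of \<open>X\<^sub>i\<close>. The vertices of all later
  players are joined to the points of one further line \<open>l\<^sub>i\<close>. If \<open>l\<^sub>i \<in> X\<^sub>i\<close> for all \<open>i\<close>, the points of
  these lines form a clique of size \<open>k\<^sup>2\<close>. If \<open>l\<^sub>i \<notin> X\<^sub>i\<close> for all \<open>i\<close>, every \<open>l\<^sub>i\<close> is independent, because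
  two lines share at most one point, so a clique has at most one vertex in each block before the
  last one it meets, and at most \<open>k\<close> in that one; it has fewer than \<open>2k\<close> vertices in total.

  Let \<open>M\<close> be the number of lines. A memory of \<open>s\<close> bits computed from a uniformly random \<open>X\<close> has a bias
  of order \<open>sqrt (s / M)\<close> towards the bit \<open>l \<in> X\<close> of a random line \<open>l\<close>, as the moment generating
  function of a sum of signs and a union bound over the memory contents show. Replacing the
  instances one at a time, the algorithm can tell the two cases apart only if \<open>k * sqrt (s / M)\<close> is
  bounded below. Integer lines \<open>y = a + b x\<close> with \<open>a < k r\<close>, \<open>b < r\<close> fit into \<open>q = 2 k r\<close> rows, so that
  \<open>r \<approx> n / (2 k\<^sup>3)\<close> is possible and \<open>M = k r\<^sup>2\<close>, whence \<open>s\<close> is at least of order \<open>n\<^sup>2 / k\<^sup>7\<close>.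
\<close>

subsection \<open>Biased bits of a compressed random set\<close>

text \<open>Weaker than cosh x <= exp (x^2 / 2), but quadratic bounds on both exponentials suffice
  for it on [-1, 1].\<close>

lemma exp_add_exp_minus_le:
  fixes x :: real
  assumes "\<bar>x\<bar> \<le> 1"
  shows "exp x + exp (- x) \<le> 2 * exp (x\<^sup>2)"
proof -
  have *: "exp y + exp (- y) \<le> 2 + 2 * y\<^sup>2" if "0 \<le> y" "y \<le> 1" for y :: real
  proof -
    \<comment> \<open>The product is 1 + y^3.\<close>
    have "1 \<le> (1 - y + y\<^sup>2) * (1 + y)"
      using that by (simp add: algebra_simps power2_eq_square)
    also have "\<dots> \<le> (1 - y + y\<^sup>2) * exp y"
      using that by (intro mult_left_mono exp_ge_add_one_self) (auto intro: add_increasing2)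
    finally have "exp (- y) \<le> 1 - y + y\<^sup>2"
      by (simp add: exp_minus inverse_eq_divide pos_divide_le_eq)
    with exp_bound[OF that] show ?thesis by simp
  qed
  have "exp x + exp (- x) \<le> 2 + 2 * x\<^sup>2"
    using *[of "\<bar>x\<bar>"] assms by (cases "x \<ge> 0") auto
  also have "\<dots> \<le> 2 * exp (x\<^sup>2)"
    using exp_ge_add_one_self[of "x\<^sup>2"] by linarith
  finally show ?thesis .
qed

text \<open>Moment generating function of independent signs weighted by \<open>g\<close>: expanding
  the product over \<open>L\<close> of two-term factors gives one summand per subset, and each
  factor is at most 2 * exp (l^2).\<close>

lemma sum_Pow_exp_signed_sum_le:
  fixes g :: "'l \<Rightarrow> real" and l :: real
  assumes fin: "finite L" and g: "\<And>j. j \<in> L \<Longrightarrow> \<bar>g j\<bar> \<le> 1" and l: "\<bar>l\<bar> \<le> 1"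
  shows "(\<Sum>X\<in>Pow L. exp (l * (\<Sum>j\<in>L. if j \<in> X then g j else - g j)))
    \<le> 2 ^ card L * exp (l\<^sup>2 * card L)"
proof -
  have split: "exp (l * (\<Sum>j\<in>L. if j \<in> X then g j else - g j))
    = (\<Prod>j\<in>X. exp (l * g j)) * (\<Prod>j\<in>L - X. exp (- (l * g j)))" if "X \<subseteq> L" for X
  proof -
    have finX: "finite X" using that fin finite_subset by blast
    have "(\<Sum>j\<in>L. if j \<in> X then g j else - g j)
      = (\<Sum>j\<in>L - X. if j \<in> X then g j else - g j) + (\<Sum>j\<in>X. if j \<in> X then g j else - g j)"
      by (rule sum.subset_diff[OF that fin])
    also have "\<dots> = (\<Sum>j\<in>L - X. - g j) + (\<Sum>j\<in>X. g j)"
      by (intro arg_cong2[where f = "(+)"] sum.cong) auto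
    finally have "l * (\<Sum>j\<in>L. if j \<in> X then g j else - g j)
      = (\<Sum>j\<in>X. l * g j) - (\<Sum>j\<in>L - X. l * g j)"
      by (simp only: sum_negf) (simp add: right_diff_distrib sum_distrib_left)
    then show ?thesis
      using fin finX by (simp add: exp_sum[symmetric] sum_negf mult_exp_exp)
  qed
  have "(\<Sum>X\<in>Pow L. exp (l * (\<Sum>j\<in>L. if j \<in> X then g j else - g j)))
    = (\<Prod>j\<in>L. exp (l * g j) + exp (- (l * g j)))"
    using fin by (simp add: prod_add split)
  also have "\<dots> \<le> (\<Prod>j\<in>L. 2 * exp (l\<^sup>2))"
  proof (rule prod_mono)
    fix j assume j: "j \<in> L"
    have "\<bar>l * g j\<bar> \<le> \<bar>l\<bar>"
      using g[OF j] by (simp add: abs_mult mult_left_le)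
    then have "\<bar>l * g j\<bar> \<le> 1" "(l * g j)\<^sup>2 \<le> l\<^sup>2"
      using l by (linarith, simp add: abs_le_square_iff)
    then have "exp (l * g j) + exp (- (l * g j)) \<le> 2 * exp (l\<^sup>2)"
      using exp_add_exp_minus_le[of "l * g j"] by (smt (verit) exp_le_cancel_iff)
    then show "0 \<le> exp (l * g j) + exp (- (l * g j)) \<and>
        exp (l * g j) + exp (- (l * g j)) \<le> 2 * exp (l\<^sup>2)"
      by (simp add: add_nonneg_nonneg)
  qed
  also have "\<dots> = 2 ^ card L * exp (l\<^sup>2 * card L)"
    by (simp add: power_mult_distrib mult.commute flip: exp_of_nat_mult)
  finally show ?thesis .
qed

text \<open>The bias of \<open>g (f X)\<close> towards \<open>X\<close> is at most the expected maximum of few sub-Gaussian variables,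
  one for each value of \<open>f\<close>.\<close>

lemma signed_sum_le_ln_card:
  fixes g :: "'m \<Rightarrow> 'l \<Rightarrow> real" and f :: "'l set \<Rightarrow> 'm" and l :: real
  assumes fin: "finite L" "finite S" and f: "\<And>X. X \<subseteq> L \<Longrightarrow> f X \<in> S"
    and g: "\<And>m j. \<bar>g m j\<bar> \<le> 1" and l: "\<bar>l\<bar> \<le> 1"
  shows "l * (\<Sum>X\<in>Pow L. \<Sum>j\<in>L. if j \<in> X then g (f X) j else - g (f X) j)
    \<le> 2 ^ card L * (ln (card S) + l\<^sup>2 * card L)"
proof -
  define Z where "Z m X = l * (\<Sum>j\<in>L. if j \<in> X then g m j else - g m j)" for m X
  define t where "t = ln (card S) + l\<^sup>2 * card L"
  have S: "card S > 0"
    using f[of "{}"] fin by (auto simp: card_gt_0_iff)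
  \<comment> \<open>\<open>f X\<close> depends on \<open>X\<close>; adding the terms of all other
    \<open>m\<close> in \<open>S\<close> removes this dependence at the cost of a factor
    \<open>card S\<close>.\<close>
  have "(\<Sum>X\<in>Pow L. exp (Z (f X) X)) \<le> (\<Sum>X\<in>Pow L. \<Sum>m\<in>S. exp (Z m X))"
    using fin f by (intro sum_mono member_le_sum[of "f _" S "\<lambda>m. exp (Z m _)"]) auto
  also have "\<dots> = (\<Sum>m\<in>S. \<Sum>X\<in>Pow L. exp (Z m X))"
    by (rule sum.swap)
  also have "\<dots> \<le> (\<Sum>m\<in>S. 2 ^ card L * exp (l\<^sup>2 * card L))"
    unfolding Z_def by (intro sum_mono sum_Pow_exp_signed_sum_le fin g l)
  also have "\<dots> = 2 ^ card L * exp t"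
    using S by (simp add: t_def exp_add)
  finally have "(\<Sum>X\<in>Pow L. exp (Z (f X) X - t)) \<le> 2 ^ card L"
    by (simp add: exp_diff divide_le_eq flip: sum_divide_distrib)
  \<comment> \<open>1 + y <= exp y plays the role of Jensen's inequality; the shift by
    \<open>t\<close> makes the average of the exponentials at most 1.\<close>
  moreover have "(\<Sum>X\<in>Pow L. 1 + (Z (f X) X - t)) \<le> (\<Sum>X\<in>Pow L. exp (Z (f X) X - t))"
    by (intro sum_mono exp_ge_add_one_self)
  ultimately have "(\<Sum>X\<in>Pow L. 1 + (Z (f X) X - t)) \<le> 2 ^ card L"
    by linarith
  then have "(\<Sum>X\<in>Pow L. Z (f X) X) \<le> 2 ^ card L * t"
    by (simp add: sum.distrib sum_subtractf card_Pow[OF fin(1)])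
  then show ?thesis
    by (simp add: Z_def t_def sum_distrib_left)
qed

subsection \<open>The hybrid argument\<close>

text \<open>Unnormalised expectation over independent uniform draws from \<open>W\<close>.\<close>

primrec list_sum :: "nat \<Rightarrow> 'a set \<Rightarrow> ('a list \<Rightarrow> real) \<Rightarrow> real" where
  "list_sum 0 W F = F []"
| "list_sum (Suc p) W F = (\<Sum>x\<in>W. list_sum p W (\<lambda>xs. F (x # xs)))"

lemma list_sum_mono:
  assumes "\<And>xs. set xs \<subseteq> W \<Longrightarrow> length xs = p \<Longrightarrow> F xs \<le> G xs"
  shows "list_sum p W F \<le> list_sum p W G"
  using assms
proof (induction p arbitrary: F G)
  case (Suc p)
  show ?case
    unfolding list_sum.simps by (intro sum_mono Suc.IH Suc.prems) auto
qed simp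

lemma list_sum_const: "list_sum p W (\<lambda>_. c) = c * real (card W) ^ p"
  by (induction p) auto

lemma list_sum_diff: "list_sum p W (\<lambda>xs. F xs - G xs) = list_sum p W F - list_sum p W G"
  by (induction p arbitrary: F G) (simp_all add: sum_subtractf)

lemma list_sum_sum: "list_sum p W (\<lambda>xs. \<Sum>y\<in>V. F y xs) = (\<Sum>y\<in>V. list_sum p W (F y))"
proof (induction p arbitrary: F)
  case (Suc p)
  show ?case
    unfolding list_sum.simps Suc.IH by (rule sum.swap)
qed simp

text \<open>Telescoping over hybrids with a prefix from \<open>V\<close> and a suffix from
  \<open>W\<close>: consecutive hybrids differ in one entry, and \<open>step\<close> bounds that
  change for each fixed choice of the other entries.\<close>

lemma list_sum_hybrid:
  assumes card: "card V = w" "card W = w"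
    and step: "\<And>ys zs. length ys + length zs + 1 = p \<Longrightarrow>
      (\<Sum>x\<in>V. F (ys @ x # zs)) - (\<Sum>x\<in>W. F (ys @ x # zs)) \<le> d * real w"
  shows "list_sum p V F - list_sum p W F \<le> real p * d * real w ^ p"
  using step
proof (induction p arbitrary: F)
  case (Suc p)
  have "list_sum (Suc p) V F - list_sum (Suc p) W F
    = (\<Sum>x\<in>V. list_sum p V (\<lambda>xs. F (x # xs)) - list_sum p W (\<lambda>xs. F (x # xs)))
      + list_sum p W (\<lambda>xs. (\<Sum>x\<in>V. F (x # xs)) - (\<Sum>x\<in>W. F (x # xs)))"
    by (simp add: list_sum_diff list_sum_sum sum_subtractf)
  also have "\<dots> \<le> (\<Sum>x\<in>V. real p * d * real w ^ p) + list_sum p W (\<lambda>xs. d * real w)"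
  proof (intro add_mono sum_mono list_sum_mono)
    fix x
    show "list_sum p V (\<lambda>xs. F (x # xs)) - list_sum p W (\<lambda>xs. F (x # xs)) \<le> real p * d * real w ^ p"
      using Suc.prems[of "x # _"] by (intro Suc.IH) auto
  next
    fix xs :: "'a list" assume "length xs = p"
    then show "(\<Sum>x\<in>V. F (x # xs)) - (\<Sum>x\<in>W. F (x # xs)) \<le> d * real w"
      using Suc.prems[of "[]" xs] by simp
  qed
  also have "\<dots> = real (Suc p) * d * real w ^ Suc p"
    by (simp add: card list_sum_const algebra_simps)
  finally show ?case .
qed simp


subsection \<open>The chained graph\<close>

text \<open>\<open>l\<close> is the pair (intercept, slope); vertex \<open>v\<close> has row
  \<open>v mod q\<close> and column \<open>v div q mod k\<close>.\<close>

definition on_line :: "nat \<Rightarrow> nat \<Rightarrow> nat \<Rightarrow> nat \<times> nat \<Rightarrow> bool" where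
  "on_line k q v l \<longleftrightarrow> v mod q = fst l + snd l * (v div q mod k)"

text \<open>Block \<open>i\<close> consists of the vertices \<open>(i * k + x) * q + y\<close> with \<open>x < k\<close> and \<open>y < q\<close>, where
  \<open>(x, y)\<close> is the position in the grid. The pair \<open>(l\<^sub>i, X\<^sub>i)\<close> of player \<open>i\<close> is \<open>ws ! i\<close>; vertices
  beyond the last block are isolated.\<close>

definition chain_adj ::
  "nat \<Rightarrow> nat \<Rightarrow> ((nat \<times> nat) \<times> (nat \<times> nat) set) list \<Rightarrow> nat \<Rightarrow> nat \<Rightarrow> bool" where
  "chain_adj k q ws u v \<longleftrightarrow> u < v \<and> v < length ws * (q * k) \<and>
     (if u div (q * k) = v div (q * k)
      then u div q mod k \<noteq> v div q mod k \<and>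
        (\<exists>l \<in> snd (ws ! (v div (q * k))). on_line k q u l \<and> on_line k q v l)
      else on_line k q u (fst (ws ! (u div (q * k)))))"

definition chain_edges ::
  "nat \<Rightarrow> nat \<Rightarrow> ((nat \<times> nat) \<times> (nat \<times> nat) set) list \<Rightarrow> nat set set" where
  "chain_edges k q ws = {{u, v} | u v. chain_adj k q ws u v}"

lemma doubleton_in_chain_edges_iff:
  assumes "u < v"
  shows "{u, v} \<in> chain_edges k q ws \<longleftrightarrow> chain_adj k q ws u v"
  using assms by (auto simp: chain_edges_def doubleton_eq_iff chain_adj_def)

lemma chain_edges_subset_nsets:
  assumes "length ws * (q * k) \<le> n"
  shows "chain_edges k q ws \<subseteq> nsets {..<n} 2"
  using assms by (auto simp: chain_edges_def chain_adj_def)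

text \<open>Agreement in two different columns forces equal slopes, hence equal intercepts. Working
  in the integers avoids truncated subtraction.\<close>

lemma lines_through_two_points:
  assumes "on_line k q u l" "on_line k q v l" "on_line k q u l'" "on_line k q v l'"
    "u div q mod k \<noteq> v div q mod k"
  shows "l = l'"
proof -
  define x y where "x = int (u div q mod k)" and "y = int (v div q mod k)"
  have u: "int (fst l) + int (snd l) * x = int (fst l') + int (snd l') * x"
    and v: "int (fst l) + int (snd l) * y = int (fst l') + int (snd l') * y"
    using assms(1-4) unfolding on_line_def x_def y_def
    by (metis of_nat_add of_nat_mult)+
  have "(int (snd l) - int (snd l')) * (x - y) = 0"
    using u v by (simp add: algebra_simps)
  moreover have "x \<noteq> y"
    using assms(5) unfolding x_def y_def by simp
  ultimately have "snd l = snd l'"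
    by simp
  with u show ?thesis
    by (simp add: prod_eq_iff)
qed

section \<open>Clique numbers in the two cases\<close>

lemma clique_card_le_clique_number:
  assumes "C \<subseteq> {..<n}" "clique C E"
  shows "card C \<le> clique_number n E"
  unfolding clique_number_def using assms by (intro Max_ge) auto

lemma clique_number_le:
  assumes "\<And>C. C \<subseteq> {..<n} \<Longrightarrow> clique C E \<Longrightarrow> card C \<le> m"
  shows "clique_number n E \<le> m"
proof -
  have "{} \<in> {C. C \<subseteq> {..<n} \<and> clique C E}"
    by (simp add: clique_def)
  then show ?thesis
    unfolding clique_number_def using assms by (intro Max.boundedI) (auto simp: finite_subset)
qed

text \<open>The clique takes the k points of the player's own line from each block: within a block
  they are adjacent because the line is in the set, across blocks because the earlier point lies on
  its own line. \<open>fits\<close> keeps the lines inside the grid.\<close>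

lemma clique_number_chain_ge:
  assumes len: "length ws * (q * k) \<le> n"
    and mem: "\<And>i. i < length ws \<Longrightarrow> fst (ws ! i) \<in> snd (ws ! i)"
    and fits: "\<And>i x. i < length ws \<Longrightarrow> x < k \<Longrightarrow> fst (fst (ws ! i)) + snd (fst (ws ! i)) * x < q"
  shows "length ws * k \<le> clique_number n (chain_edges k q ws)"
proof -
  let ?pt = "\<lambda>(i, x). (i * k + x) * q + (fst (fst (ws ! i)) + snd (fst (ws ! i)) * x)"
  define C where "C = ?pt ` ({..<length ws} \<times> {..<k})"
  have pt: "?pt (i, x) div q = i * k + x" "?pt (i, x) div (q * k) = i"
    "?pt (i, x) div q mod k = x" "on_line k q (?pt (i, x)) (fst (ws ! i))"
    "?pt (i, x) < length ws * (q * k)"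
    if "i < length ws" "x < k" for i x
  proof -
    let ?y = "fst (fst (ws ! i)) + snd (fst (ws ! i)) * x"
    have y: "?y < q" using fits that by blast
    show 1: "?pt (i, x) div q = i * k + x"
      using y by (simp only: prod.case) simp
    show 2: "?pt (i, x) div (q * k) = i"
      unfolding div_mult2_eq 1 using that by simp
    show 3: "?pt (i, x) div q mod k = x"
      unfolding 1 using that by simp
    have "?pt (i, x) mod q = ?y"
      using y by (simp only: prod.case) simp
    then show "on_line k q (?pt (i, x)) (fst (ws ! i))"
      unfolding on_line_def 3 .
    have "?pt (i, x) div (q * k) < length ws" using 2 that by simp
    then show "?pt (i, x) < length ws * (q * k)"
      using y that by (subst (asm) div_less_iff_less_mult) auto
  qed
  have inj: "inj_on ?pt ({..<length ws} \<times> {..<k})"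
  proof (rule inj_onI)
    fix a b assume a: "a \<in> {..<length ws} \<times> {..<k}" and b: "b \<in> {..<length ws} \<times> {..<k}"
      and eq: "?pt a = ?pt b"
    obtain i x j y where "a = (i, x)" "b = (j, y)" by (metis surj_pair)
    with a b eq show "a = b"
      using pt(2,3)[of i x] pt(2,3)[of j y] by auto
  qed
  have "card C = length ws * k"
    unfolding C_def by (subst card_image[OF inj]) (simp add: card_cartesian_product)
  moreover have sub: "C \<subseteq> {..<n}"
    using pt(5) len unfolding C_def by fastforce
  moreover have "clique C (chain_edges k q ws)"
  proof -
    have adj: "chain_adj k q ws u v" if uv: "u \<in> C" "v \<in> C" "u < v" for u v
    proof -
      obtain i x j y where u: "i < length ws" "x < k" "u = ?pt (i, x)"
        and v: "j < length ws" "y < k" "v = ?pt (j, y)"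
        using uv(1,2) unfolding C_def by blast
      note pu = pt[OF u(1,2), folded u(3)] and pv = pt[OF v(1,2), folded v(3)]
      show ?thesis
      proof (cases "i = j")
        case True
        then have "x \<noteq> y" using u v uv by auto
        then show ?thesis
          using True pu pv uv mem[OF v(1)] unfolding chain_adj_def by auto
      next
        case False
        then show ?thesis
          using pu pv uv unfolding chain_adj_def by auto
      qed
    qed
    show ?thesis
      unfolding clique_def
    proof (intro ballI impI)
      fix u v assume "u \<in> C" "v \<in> C" "u \<noteq> v"
      then show "{u, v} \<in> chain_edges k q ws"
        using adj[of u v] adj[of v u] doubleton_in_chain_edges_iff[of u v k q ws]
          doubleton_in_chain_edges_iff[of v u k q ws]
        by (cases "u < v") (auto simp: insert_commute)
    qed
  qed
  ultimately show ?thesis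
    using clique_card_le_clique_number by metis
qed

text \<open>Clique vertices in the block of the largest one \<open>z\<close> have distinct columns.
  All others lie in earlier blocks and, being joined to \<open>z\<close>, on their own block's line.
  Two of them in one block would also share a line of the set, which by uniqueness is the excluded
  one.\<close>

lemma clique_number_chain_less:
  assumes k: "k > 0" and q: "q > 0" and ws: "ws \<noteq> []"
    and notin: "\<And>i. i < length ws \<Longrightarrow> fst (ws ! i) \<notin> snd (ws ! i)"
  shows "clique_number n (chain_edges k q ws) < length ws + k"
proof -
  have "clique_number n (chain_edges k q ws) \<le> length ws - 1 + k"
  proof (rule clique_number_le)
    fix C assume "C \<subseteq> {..<n}" and cl: "clique C (chain_edges k q ws)"
    then have fin: "finite C" by (simp add: finite_subset)
    have adj: "chain_adj k q ws u v" if "u \<in> C" "v \<in> C" "u < v" for u v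
      using cl that doubleton_in_chain_edges_iff[of u v k q ws] unfolding clique_def by auto
    show "card C \<le> length ws - 1 + k"
    proof (cases "card C \<le> 1")
      case True
      with k show ?thesis by simp
    next
      case False
      then have "C \<noteq> {}" by auto
      define z where "z = Max C"
      have z: "z \<in> C" "\<And>v. v \<in> C \<Longrightarrow> v \<le> z"
        using fin \<open>C \<noteq> {}\<close> by (auto simp: z_def)
      \<comment> \<open>A second vertex shows that \<open>z\<close> has a neighbour and so lies in a
        block, not among the isolated vertices.\<close>
      obtain u where "u \<in> C" "u \<noteq> z"
        using False fin by (metis \<open>C \<noteq> {}\<close> card_1_singleton_iff card_le_Suc0_iff_eq One_nat_def z(1))
      then have "chain_adj k q ws u z"
        using z adj[of u z] by (simp add: order_less_le)
      then have "z < length ws * (q * k)"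
        by (simp add: chain_adj_def)
      then have zdiv: "z div (q * k) < length ws"
        using k q by (simp add: div_less_iff_less_mult)
      define T where "T = {v \<in> C. v div (q * k) = z div (q * k)}"
      have "inj_on (\<lambda>v. v div q mod k) T"
      proof (rule linorder_inj_onI')
        fix u v assume "u \<in> T" "v \<in> T" "u < v"
        then show "u div q mod k \<noteq> v div q mod k"
          using adj[of u v] by (auto simp: T_def chain_adj_def)
      qed
      moreover have "(\<lambda>v. v div q mod k) ` T \<subseteq> {..<k}"
        using k by auto
      ultimately have "card T \<le> k"
        using card_inj_on_le[of _ T "{..<k}"] by auto
      have "inj_on (\<lambda>v. v div (q * k)) (C - T)"
      proof (rule linorder_inj_onI', rule notI)
        fix u v assume u: "u \<in> C - T" and v: "v \<in> C - T" and "u < v"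
          and eq: "u div (q * k) = v div (q * k)"
        have on: "on_line k q w (fst (ws ! (w div (q * k))))" if "w \<in> C - T" for w
          using that z adj[of w z] unfolding T_def chain_adj_def
          by (metis (mono_tags, lifting) DiffD1 DiffD2 mem_Collect_eq order_less_le)
        have "chain_adj k q ws u v"
          using adj u v \<open>u < v\<close> by blast
        then obtain l where l: "l \<in> snd (ws ! (v div (q * k)))" "on_line k q u l" "on_line k q v l"
          "u div q mod k \<noteq> v div q mod k"
          unfolding chain_adj_def using eq by auto
        have "fst (ws ! (v div (q * k))) = l"
          using lines_through_two_points[OF _ _ l(2-4)] on[OF u] on[OF v] eq by simp
        moreover have "v div (q * k) < length ws"
          using zdiv z(2)[of v] v by (meson DiffD1 div_le_mono le_less_trans)
        ultimately show False
          using notin l(1) by blast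
      qed
      moreover have "(\<lambda>v. v div (q * k)) ` (C - T) \<subseteq> {..<z div (q * k)}"
      proof (rule image_subsetI)
        fix v assume v: "v \<in> C - T"
        then have "v div (q * k) \<le> z div (q * k)"
          using z by (simp add: div_le_mono)
        then show "v div (q * k) \<in> {..<z div (q * k)}"
          using v by (auto simp: T_def)
      qed
      ultimately have "card (C - T) \<le> z div (q * k)"
        using card_inj_on_le[of _ "C - T" "{..<z div (q * k)}"] by auto
      moreover have "card C = card T + card (C - T)"
        using fin by (metis (no_types, lifting) T_def card_Diff_subset card_mono finite_subset
            le_add_diff_inverse mem_Collect_eq subsetI)
      ultimately show ?thesis
        using \<open>card T \<le> k\<close> zdiv by linarith
    qed
  qed
  then show ?thesis
    using ws by (cases ws) auto
qed

section \<open>The chain as a stream, block after block\<close>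

definition chain_stream ::
  "nat \<Rightarrow> nat \<Rightarrow> nat \<Rightarrow> ((nat \<times> nat) \<times> (nat \<times> nat) set) list \<Rightarrow> item list" where
  "chain_stream n k q ws = vertex_stream (chain_edges k q ws) [0..<n]"

lemma chain_stream_in_vertex_streams:
  assumes "length ws * (q * k) \<le> n"
  shows "(chain_edges k q ws, chain_stream n k q ws) \<in> vertex_streams n"
proof -
  have "distinct [0..<n]" "set [0..<n] = {..<n}" by auto
  with chain_edges_subset_nsets[OF assms] show ?thesis
    unfolding vertex_streams_def chain_stream_def by blast
qed

lemma length_chain_stream [simp]: "length (chain_stream n k q ws) = n"
  by (simp add: chain_stream_def vertex_stream_def)

lemma nth_chain_stream:
  assumes "i < n"
  shows "chain_stream n k q ws ! i = (i, {{i, j} | j. j < i \<and> chain_adj k q ws j i})"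
proof -
  have "chain_stream n k q ws ! i
    = (i, {{i, [0..<n] ! j} | j. j < i \<and> {i, [0..<n] ! j} \<in> chain_edges k q ws})"
    using assms by (simp add: chain_stream_def vertex_stream_def)
  also have "{{i, [0..<n] ! j} | j. j < i \<and> {i, [0..<n] ! j} \<in> chain_edges k q ws}
    = {{i, j} | j. j < i \<and> chain_adj k q ws j i}"
    using assms by (intro Collect_cong iff_exI)
      (auto simp: insert_commute[of i] doubleton_in_chain_edges_iff)
  finally show ?thesis .
qed

text \<open>The block of the \<open>t\<close>-th player does not reveal its own line, and all later blocks only
  reveal that line.\<close>

lemma take_chain_stream_cong:
  "take (Suc (length ys) * (q * k)) (chain_stream n k q (ys @ (l, X) # zs))
   = take (Suc (length ys) * (q * k)) (chain_stream n k q (ys @ (l', X) # zs))"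
proof (rule nth_equalityI)
  fix i assume "i < length (take (Suc (length ys) * (q * k)) (chain_stream n k q (ys @ (l, X) # zs)))"
  then have i: "i < Suc (length ys) * (q * k)" "i < n" by auto
  then have d: "i div (q * k) \<le> length ys"
    by (simp add: less_Suc_eq_le[symmetric] less_mult_imp_div_less)
  have "chain_adj k q (ys @ (l, X) # zs) j i \<longleftrightarrow> chain_adj k q (ys @ (l', X) # zs) j i"
    if "j < i" for j
  proof -
    \<comment> \<open>Before the cut, lines are consulted only for blocks strictly before that of
      \<open>i\<close>, so never the line \<open>l\<close>.\<close>
    have "j div (q * k) \<le> i div (q * k)" using that by (simp add: div_le_mono)
    with d have "j div (q * k) < length ys" if "j div (q * k) \<noteq> i div (q * k)"
      using that by linarith
    moreover have "snd ((ys @ (l, X) # zs) ! (i div (q * k))) = snd ((ys @ (l', X) # zs) ! (i div (q * k)))"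
      using d by (auto simp: nth_append nth_Cons')
    ultimately show ?thesis
      unfolding chain_adj_def by (auto simp: nth_append)
  qed
  with i show "take (Suc (length ys) * (q * k)) (chain_stream n k q (ys @ (l, X) # zs)) ! i
   = take (Suc (length ys) * (q * k)) (chain_stream n k q (ys @ (l', X) # zs)) ! i"
    by (auto simp: nth_chain_stream)
qed simp

lemma drop_chain_stream_cong:
  assumes "q * k > 0"
  shows "drop (Suc (length ys) * (q * k)) (chain_stream n k q (ys @ (l, X) # zs))
   = drop (Suc (length ys) * (q * k)) (chain_stream n k q (ys @ (l, Y) # zs))"
proof (rule nth_equalityI)
  let ?m = "Suc (length ys) * (q * k)"
  fix i assume "i < length (drop ?m (chain_stream n k q (ys @ (l, X) # zs)))"
  then have i: "?m + i < n" by auto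
  \<comment> \<open>Vertices arriving after the cut have a larger block index, so their adjacency
    never consults the set \<open>X\<close>.\<close>
  have "Suc (length ys) \<le> (?m + i) div (q * k)"
    using assms by (simp add: less_eq_div_iff_mult_less_eq)
  then have "(ys @ (l, X) # zs) ! ((?m + i) div (q * k)) = (ys @ (l, Y) # zs) ! ((?m + i) div (q * k))"
    by (auto simp: nth_append nth_Cons')
  moreover have "fst ((ys @ (l, X) # zs) ! j) = fst ((ys @ (l, Y) # zs) ! j)" for j
    by (auto simp: nth_append nth_Cons')
  ultimately have "chain_adj k q (ys @ (l, X) # zs) j (?m + i)
      \<longleftrightarrow> chain_adj k q (ys @ (l, Y) # zs) j (?m + i)" for j
    unfolding chain_adj_def by simp
  with i show "drop ?m (chain_stream n k q (ys @ (l, X) # zs)) ! i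
   = drop ?m (chain_stream n k q (ys @ (l, Y) # zs)) ! i"
    by (simp add: nth_chain_stream)
qed simp


subsection \<open>The space bound\<close>

lemma card_pairs_mem_eq_card_pairs_notin:
  "card {w \<in> L \<times> Pow L. fst w \<in> snd w} = card {w \<in> L \<times> Pow L. fst w \<notin> snd w}"
proof (rule bij_betw_same_card)
  show "bij_betw (\<lambda>w. (fst w, L - snd w))
    {w \<in> L \<times> Pow L. fst w \<in> snd w} {w \<in> L \<times> Pow L. fst w \<notin> snd w}"
    by (rule bij_betw_byWitness[where f' = "\<lambda>w. (fst w, L - snd w)"]) auto
qed

lemma card_pairs_mem:
  assumes "finite L"
  shows "2 * card {w \<in> L \<times> Pow L. fst w \<in> snd w} = card L * 2 ^ card L"
proof -
  let ?V = "{w \<in> L \<times> Pow L. fst w \<in> snd w}" and ?W = "{w \<in> L \<times> Pow L. fst w \<notin> snd w}"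
  have "?V \<union> ?W = L \<times> Pow L" "?V \<inter> ?W = {}" by auto
  then have "card ?V + card ?W = card (L \<times> Pow L)"
    using card_Un_disjoint[of ?V ?W] assms by simp
  also have "\<dots> = card L * 2 ^ card L"
    using assms by (simp add: card_cartesian_product card_Pow)
  finally show ?thesis
    by (simp add: card_pairs_mem_eq_card_pairs_notin)
qed

text \<open>Brings the difference between positive and negative instances into the signed form
  bounded by \<open>signed_sum_le_ln_card\<close>.\<close>

lemma sum_pairs_mem_minus_notin:
  fixes h :: "'l \<times> 'l set \<Rightarrow> real"
  assumes "finite L"
  shows "sum h {w \<in> L \<times> Pow L. fst w \<in> snd w} - sum h {w \<in> L \<times> Pow L. fst w \<notin> snd w}
    = (\<Sum>X\<in>Pow L. \<Sum>l\<in>L. if l \<in> X then h (l, X) else - h (l, X))"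
proof -
  have "(\<Sum>X\<in>Pow L. \<Sum>l\<in>L. if l \<in> X then h (l, X) else - h (l, X))
    = (\<Sum>w\<in>L \<times> Pow L. if fst w \<in> snd w then h w else - h w)"
    by (subst sum.swap) (simp add: sum.cartesian_product case_prod_unfold cong: if_cong)
  also have "\<dots> = sum h (L \<times> Pow L \<inter> {w. fst w \<in> snd w})
      - sum h (L \<times> Pow L \<inter> - {w. fst w \<in> snd w})"
    using assms by (simp add: sum.If_cases sum_negf)
  also have "L \<times> Pow L \<inter> {w. fst w \<in> snd w} = {w \<in> L \<times> Pow L. fst w \<in> snd w}"
    by auto
  also have "L \<times> Pow L \<inter> - {w. fst w \<in> snd w} = {w \<in> L \<times> Pow L. fst w \<notin> snd w}"
    by auto
  finally show ?thesis by simp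
qed

lemma ln_card_bool_lists_le: "ln (real (card {m :: bool list. length m \<le> s})) \<le> real s + 1"
proof -
  have "card {m :: bool list. length m \<le> s} = (\<Sum>i\<le>s. 2 ^ i)"
    using card_lists_length_le[of "UNIV :: bool set" s] by simp
  also have "\<dots> < 2 ^ (s + 1)"
    by (induction s) auto
  finally have "real (card {m :: bool list. length m \<le> s}) \<le> 2 ^ (s + 1)"
    by (metis less_imp_le of_nat_le_iff of_nat_numeral of_nat_power)
  moreover have "card {m :: bool list. length m \<le> s} > 0"
    using finite_lists_length_le[of "UNIV :: bool set" s] by (auto simp: card_gt_0_iff intro: exI[of _ "[]"])
  ultimately have "ln (real (card {m :: bool list. length m \<le> s})) \<le> ln (2 ^ (s + 1))"
    by (subst ln_le_cancel_iff) auto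
  also have "\<dots> = (real s + 1) * ln 2"
    by (simp add: ln_realpow del: power_Suc)
  also have "\<dots> \<le> (real s + 1) * 1"
    using ln_2_less_1 by (intro mult_left_mono) auto
  finally show ?thesis by simp
qed

lemma answer_take_drop:
  "answer a xs = result a (foldl (update a) (memory_after a (take m xs)) (drop m xs))"
  unfolding answer_def memory_after_def by (metis append_take_drop_id foldl_append)

text \<open>Cut the run after the block of the player between \<open>ys\<close> and
  \<open>zs\<close>, all else being fixed. The memory there depends on \<open>X\<close> alone and
  the rest of the stream on \<open>l\<close> alone, so acceptance is a test of the compressed set
  \<open>f X\<close> at \<open>l\<close>, to which the bias bound applies.\<close>

lemma chain_step:
  fixes x T :: real
  assumes fin: "finite L" and qk: "q * k > 0" and x: "\<bar>x\<bar> \<le> 1"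
    and space: "\<And>X. length (memory_after a (take (Suc (length ys) * (q * k))
        (chain_stream n k q (ys @ ((0, 0), X) # zs)))) \<le> s"
  defines "h \<equiv> \<lambda>w. indicator {a. T \<le> answer a (chain_stream n k q (ys @ w # zs))} a"
  shows "x * (sum h {w \<in> L \<times> Pow L. fst w \<in> snd w} - sum h {w \<in> L \<times> Pow L. fst w \<notin> snd w})
    \<le> 2 ^ card L * (real s + 1 + x\<^sup>2 * card L)"
proof -
  let ?m = "Suc (length ys) * (q * k)" and ?S = "{m :: bool list. length m \<le> s}"
  \<comment> \<open>The line (0, 0) here and the set {} in \<open>g\<close> are placeholders for
    what that portion of the stream does not show.\<close>
  define f where "f X = memory_after a (take ?m (chain_stream n k q (ys @ ((0, 0), X) # zs)))" for X
  define g :: "bool list \<Rightarrow> nat \<times> nat \<Rightarrow> real" where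
    "g mem l = of_bool (T \<le> result a (foldl (update a) mem
      (drop ?m (chain_stream n k q (ys @ (l, {}) # zs)))))" for mem l
  have h: "h (l, X) = g (f X) l" for l X
    unfolding h_def g_def f_def indicator_def
    by (simp only: answer_take_drop[where m = ?m] mem_Collect_eq
        take_chain_stream_cong[of ys q k n l X zs "(0, 0)"] drop_chain_stream_cong[OF qk, of ys n l X zs "{}"])
  have "x * (\<Sum>X\<in>Pow L. \<Sum>l\<in>L. if l \<in> X then g (f X) l else - g (f X) l)
    \<le> 2 ^ card L * (ln (card ?S) + x\<^sup>2 * card L)"
  proof (rule signed_sum_le_ln_card[OF fin _ _ _ x])
    show "finite ?S"
      using finite_lists_length_le[of "UNIV :: bool set" s] by simp
    show "f X \<in> ?S" for X
      using space by (simp add: f_def)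
    show "\<bar>g m j\<bar> \<le> 1" for m j
      by (simp add: g_def)
  qed
  also have "\<dots> \<le> 2 ^ card L * (real s + 1 + x\<^sup>2 * card L)"
    using ln_card_bool_lists_le[of s] by (intro mult_left_mono) auto
  finally show ?thesis
    unfolding sum_pairs_mem_minus_notin[OF fin] h .
qed

text \<open>The bound of \<open>chain_step\<close> holds for every outcome of the coins, so it
  survives averaging.\<close>

lemma chain_step_random:
  fixes x T :: real
  assumes fin: "finite L" and qk: "q * k > 0" and x: "\<bar>x\<bar> \<le> 1"
    and n: "(length ys + length zs + 1) * (q * k) \<le> n" and space: "uses_space n s A"
  defines "F \<equiv> \<lambda>ws. measure_pmf.prob A {a. T \<le> answer a (chain_stream n k q ws)}"
  shows "x * ((\<Sum>w | w \<in> L \<times> Pow L \<and> fst w \<in> snd w. F (ys @ w # zs))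
      - (\<Sum>w | w \<in> L \<times> Pow L \<and> fst w \<notin> snd w. F (ys @ w # zs)))
    \<le> 2 ^ card L * (real s + 1 + x\<^sup>2 * card L)"
proof -
  define h :: "(nat \<times> nat) \<times> (nat \<times> nat) set \<Rightarrow> stream_alg \<Rightarrow> real" where
    "h w = indicator {a. T \<le> answer a (chain_stream n k q (ys @ w # zs))}" for w
  have int: "integrable (measure_pmf A) (h w)" for w
    unfolding h_def by (rule integrable_real_indicator) (auto simp: measure_pmf.emeasure_eq_measure)
  have F: "F (ys @ w # zs) = (\<integral>a. h w a \<partial>A)" for w
    by (simp add: F_def h_def)
  have "x * ((\<Sum>w | w \<in> L \<times> Pow L \<and> fst w \<in> snd w. F (ys @ w # zs))
      - (\<Sum>w | w \<in> L \<times> Pow L \<and> fst w \<notin> snd w. F (ys @ w # zs)))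
    = (\<integral>a. x * ((\<Sum>w | w \<in> L \<times> Pow L \<and> fst w \<in> snd w. h w a)
      - (\<Sum>w | w \<in> L \<times> Pow L \<and> fst w \<notin> snd w. h w a)) \<partial>A)"
    by (simp add: F int)
  also have "\<dots> \<le> 2 ^ card L * (real s + 1 + x\<^sup>2 * card L)"
  proof (rule measure_pmf.integral_le_const)
    show "integrable (measure_pmf A) (\<lambda>a. x * ((\<Sum>w | w \<in> L \<times> Pow L \<and> fst w \<in> snd w. h w a)
      - (\<Sum>w | w \<in> L \<times> Pow L \<and> fst w \<notin> snd w. h w a)))"
      by (intro integrable_mult_right Bochner_Integration.integrable_diff Bochner_Integration.integrable_sum int)
    have "x * ((\<Sum>w | w \<in> L \<times> Pow L \<and> fst w \<in> snd w. h w a)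
      - (\<Sum>w | w \<in> L \<times> Pow L \<and> fst w \<notin> snd w. h w a))
      \<le> 2 ^ card L * (real s + 1 + x\<^sup>2 * card L)" if a: "a \<in> set_pmf A" for a
      unfolding h_def
    proof (rule chain_step[OF fin qk x])
      fix X
      \<comment> \<open>The placeholder line still gives a genuine vertex stream, so the space bound
        covers it.\<close>
      let ?ws = "ys @ ((0, 0), X) # zs"
      have "(chain_edges k q ?ws, chain_stream n k q ?ws) \<in> vertex_streams n"
        using n by (intro chain_stream_in_vertex_streams) simp
      moreover have "Suc (length ys) * (q * k) \<le> n"
        using n by (rule le_trans[rotated]) simp
      ultimately show "length (memory_after a (take (Suc (length ys) * (q * k))
          (chain_stream n k q ?ws))) \<le> s"
        using space a unfolding uses_space_def by blast
    qed
    then show "AE a in measure_pmf A. x * ((\<Sum>w | w \<in> L \<times> Pow L \<and> fst w \<in> snd w. h w a)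
      - (\<Sum>w | w \<in> L \<times> Pow L \<and> fst w \<notin> snd w. h w a))
      \<le> 2 ^ card L * (real s + 1 + x\<^sup>2 * card L)"
      by (simp add: AE_measure_pmf_iff)
  qed
  finally show ?thesis .
qed

text \<open>The threshold 2k separates the cases: k^2 / c >= 2k since k >= 2c, while negative chains
  have clique number below 2k. Acceptance probabilities are thus at least 2/3 and at most 1/3, and
  the k hybrid steps must bridge a gap of 1/3.\<close>

lemma chain_space_lower_bound:
  fixes c :: real
  assumes c: "1 \<le> c" and k: "2 * c \<le> real k" and r: "r > 0" and n: "2 * k ^ 3 * r \<le> n"
    and approx: "approximates_clique_number n c A" and space: "uses_space n s A"
  shows "real (k * r\<^sup>2) \<le> 144 * (real k)\<^sup>2 * (real s + 1)"
proof -
  \<comment> \<open>Enough rows: the intercept is below kr, and slope times column is at most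
    kr.\<close>
  define q where "q = 2 * k * r"
  define L where "L = {..<k * r} \<times> {..<r}"
  define V where "V = {w \<in> L \<times> Pow L. fst w \<in> snd w}"
  define W where "W = {w \<in> L \<times> Pow L. fst w \<notin> snd w}"
  define F where "F ws = measure_pmf.prob A {a. 2 * real k \<le> answer a (chain_stream n k q ws)}" for ws
  \<comment> \<open>Makes the contribution 2 * x * k of the quadratic term to \<open>k * d\<close>
    equal to 1/6, half of the gap.\<close>
  define x where "x = 1 / (12 * real k)"
  \<comment> \<open>The bound of \<open>chain_step_random\<close> divided by \<open>x\<close> and by
    the size of \<open>V\<close>, which is half of all pairs.\<close>
  define d where "d = 2 / (x * card L) * (real s + 1 + x\<^sup>2 * card L)"
  have kpos: "k > 0" using c k by (cases k) auto
  then have qpos: "q > 0" and qk: "q * k > 0" using r by (auto simp: q_def)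
  have n': "k * (q * k) \<le> n"
    using n by (simp add: q_def power3_eq_cube mult_ac)
  have fin: "finite L" and cardL: "card L = k * r\<^sup>2"
    by (auto simp: L_def card_cartesian_product power2_eq_square)
  have Mpos: "card L > 0" using kpos r by (simp add: cardL)
  have x: "x > 0" "\<bar>x\<bar> \<le> 1" using kpos by (auto simp: x_def)
  have cardVW: "card W = card V"
    unfolding V_def W_def by (rule card_pairs_mem_eq_card_pairs_notin[symmetric])
  have "2 * real (card V) = real (card L) * 2 ^ card L"
    using arg_cong[OF card_pairs_mem[OF fin], of real] by (simp add: V_def)
  then have cardV: "real (card V) = real (card L) * 2 ^ card L / 2" by simp
  have wpos: "real (card V) > 0" unfolding cardV using Mpos by simp

  have step: "(\<Sum>w\<in>V. F (ys @ w # zs)) - (\<Sum>w\<in>W. F (ys @ w # zs)) \<le> d * real (card V)"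
    if "length ys + length zs + 1 = k" for ys zs
  proof -
    have "x * ((\<Sum>w\<in>V. F (ys @ w # zs)) - (\<Sum>w\<in>W. F (ys @ w # zs)))
      \<le> 2 ^ card L * (real s + 1 + x\<^sup>2 * card L)"
      unfolding V_def W_def F_def using that n'
      by (intro chain_step_random fin qk x space) auto
    also have "\<dots> = x * (d * real (card V))"
      using x Mpos by (simp add: cardV d_def)
    finally show ?thesis using x by simp
  qed
  have "list_sum k V F - list_sum k W F \<le> real k * d * real (card V) ^ k"
    by (rule list_sum_hybrid[OF refl cardVW step])
  moreover have "2 / 3 * real (card V) ^ k \<le> list_sum k V F"
    unfolding list_sum_const[symmetric]
  proof (rule list_sum_mono)
    fix ws assume ws: "set ws \<subseteq> V" "length ws = k"
    have mem: "ws ! i \<in> V" if "i < length ws" for i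
      using ws that by auto
    let ?E = "chain_edges k q ws" and ?xs = "chain_stream n k q ws"
    have "length ws * k \<le> clique_number n ?E"
    proof (rule clique_number_chain_ge)
      show "length ws * (q * k) \<le> n" using n' ws by simp
      show "fst (ws ! i) \<in> snd (ws ! i)" if "i < length ws" for i
        using mem[OF that] by (simp add: V_def)
      show "fst (fst (ws ! i)) + snd (fst (ws ! i)) * y < q" if "i < length ws" "y < k" for i y
      proof -
        have "fst (fst (ws ! i)) < k * r" "snd (fst (ws ! i)) < r"
          using mem[OF that(1)] by (auto simp: V_def L_def)
        moreover from this that have "snd (fst (ws ! i)) * y \<le> r * k"
          by (intro mult_le_mono) auto
        ultimately show ?thesis by (simp add: q_def mult.assoc mult.commute[of r k])
      qed
    qed
    then have "real (k * k) \<le> real (clique_number n ?E)" using ws by (simp del: of_nat_mult)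
    then have "1 / c * (real k * real k) \<le> 1 / c * real (clique_number n ?E)"
      using c by (intro mult_left_mono) auto
    moreover have "2 * real k \<le> 1 / c * (real k * real k)"
      using c k mult_right_mono[OF k, of "real k"] by (simp add: field_simps)
    ultimately have "2 * real k \<le> 1 / c * real (clique_number n ?E)" by linarith
    then have "{a. is_approximation c (real (clique_number n ?E)) (answer a ?xs)}
        \<subseteq> {a. 2 * real k \<le> answer a ?xs}"
      by (auto simp: is_approximation_def)
    then have "measure_pmf.prob A {a. is_approximation c (real (clique_number n ?E)) (answer a ?xs)}
        \<le> F ws"
      unfolding F_def by (rule measure_pmf.finite_measure_mono) simp
    moreover have "(?E, ?xs) \<in> vertex_streams n"
      using n' ws by (intro chain_stream_in_vertex_streams) simp
    ultimately show "2 / 3 \<le> F ws"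
      using approx unfolding approximates_clique_number_def by fastforce
  qed
  moreover have "list_sum k W F \<le> 1 / 3 * real (card V) ^ k"
    unfolding list_sum_const[symmetric] cardVW[symmetric]
  proof (rule list_sum_mono)
    fix ws assume ws: "set ws \<subseteq> W" "length ws = k"
    let ?E = "chain_edges k q ws" and ?xs = "chain_stream n k q ws"
    have "clique_number n ?E < length ws + k"
    proof (rule clique_number_chain_less[OF kpos qpos])
      show "ws \<noteq> []" using ws kpos by auto
      show "fst (ws ! i) \<notin> snd (ws ! i)" if "i < length ws" for i
        using nth_mem[OF that] ws by (auto simp: W_def)
    qed
    then have "real (clique_number n ?E) < 2 * real k" using ws by simp
    then have "{a. 2 * real k \<le> answer a ?xs}
        \<subseteq> UNIV - {a. is_approximation c (real (clique_number n ?E)) (answer a ?xs)}"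
      by (auto simp: is_approximation_def)
    then have "F ws \<le> measure_pmf.prob A
        (UNIV - {a. is_approximation c (real (clique_number n ?E)) (answer a ?xs)})"
      unfolding F_def by (rule measure_pmf.finite_measure_mono) simp
    also have "\<dots> = 1 - measure_pmf.prob A
        {a. is_approximation c (real (clique_number n ?E)) (answer a ?xs)}"
      using measure_pmf.prob_compl[of "{a. is_approximation c (real (clique_number n ?E)) (answer a ?xs)}" A]
      by simp
    finally have "F ws \<le> 1 - measure_pmf.prob A
        {a. is_approximation c (real (clique_number n ?E)) (answer a ?xs)}" .
    moreover have "(?E, ?xs) \<in> vertex_streams n"
      using n' ws by (intro chain_stream_in_vertex_streams) simp
    ultimately show "F ws \<le> 1 / 3"
      using approx unfolding approximates_clique_number_def by fastforce
  qed
  ultimately have "1 / 3 * real (card V) ^ k \<le> real k * d * real (card V) ^ k"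
    by linarith
  then have "1 / 3 \<le> real k * d"
    using wpos by simp
  also have "real k * d = 24 * (real k)\<^sup>2 * (real s + 1) / card L + 1 / 6"
    using kpos Mpos by (simp add: d_def x_def field_simps power2_eq_square)
  finally have "1 / 6 \<le> 24 * (real k)\<^sup>2 * (real s + 1) / card L" by simp
  then show ?thesis
    using Mpos by (simp add: cardL field_simps)
qed

text \<open>Without memory the answer ignores the graph, but no value serves both the empty graph
  (clique number at most 1) and the complete one (at least n > c), so two events of probability at
  least 2/3 would be disjoint. This later turns s + 1 into 2s and settles the case of n small
  compared to c.\<close>

lemma space_pos:
  assumes c: "1 \<le> c" "c < real n"
    and approx: "approximates_clique_number n c A" and space: "uses_space n s A"
  shows "s \<ge> 1"
proof (rule ccontr)
  assume "\<not> s \<ge> 1"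
  then have s: "s = 0" by simp
  let ?K = "nsets {..<n} 2"
  let ?xs = "\<lambda>E. vertex_stream E [0..<n]"
  let ?P = "\<lambda>E. {a. is_approximation c (real (clique_number n E)) (answer a (?xs E))}"
  have streams: "(E, ?xs E) \<in> vertex_streams n" if "E \<subseteq> ?K" for E
  proof -
    have "distinct [0..<n]" "set [0..<n] = {..<n}" by auto
    with that show ?thesis unfolding vertex_streams_def by blast
  qed
  have P: "measure_pmf.prob A (?P E) \<ge> 2 / 3" if "E \<subseteq> ?K" for E
    using approx streams[OF that] unfolding approximates_clique_number_def by fastforce
  have ans: "answer a (?xs E) = result a []" if "a \<in> set_pmf A" "E \<subseteq> ?K" for a E
  proof -
    have "length (memory_after a (take n (?xs E))) \<le> s"
      using space that(1) streams[OF that(2)] unfolding uses_space_def by blast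
    moreover have "take n (?xs E) = ?xs E"
      by (simp add: vertex_stream_def)
    ultimately show ?thesis
      using s by (simp add: answer_def)
  qed
  have empty: "clique_number n {} \<le> 1"
  proof (rule clique_number_le)
    fix C :: "nat set" assume "C \<subseteq> {..<n}" "clique C {}"
    then show "card C \<le> 1"
      using card_le_Suc0_iff_eq[of C] by (auto simp: clique_def finite_subset)
  qed
  have complete: "n \<le> clique_number n ?K"
    using clique_card_le_clique_number[of "{..<n}" n ?K] by (auto simp: clique_def)
  have "AE a in measure_pmf A. a \<in> ?P ?K \<longrightarrow> a \<in> UNIV - ?P {}"
    unfolding AE_measure_pmf_iff
  proof (intro ballI impI)
    fix a assume a: "a \<in> set_pmf A" "a \<in> ?P ?K"
    have "1 < 1 / c * real n"
      using c by (simp add: field_simps)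
    also have "\<dots> \<le> 1 / c * real (clique_number n ?K)"
      using complete c by (intro mult_left_mono) auto
    also have "\<dots> \<le> result a []"
      using a ans[of a ?K] by (simp add: is_approximation_def)
    finally show "a \<in> UNIV - ?P {}"
      using ans[of a "{}"] a empty by (auto simp: is_approximation_def)
  qed
  then have "measure_pmf.prob A (?P ?K) \<le> measure_pmf.prob A (UNIV - ?P {})"
    by (rule measure_pmf.finite_measure_mono_AE) simp
  also have "\<dots> = 1 - measure_pmf.prob A (?P {})"
    using measure_pmf.prob_compl[of "?P {}" A] by simp
  finally show False
    using P[of ?K] P[of "{}"] by simp
qed

theorem theorem9:
  shows "\<exists>K::real. K > 0 \<and>
    (\<forall>\<^sub>F n::nat in sequentially.
      \<forall>(c::real) (s::nat) (A::random_stream_alg).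
        1 \<le> c \<longrightarrow> c < real n \<longrightarrow>
        approximates_clique_number n c A \<longrightarrow> uses_space n s A \<longrightarrow>
        real s \<ge> K * ((real n)\<^sup>2 / c ^ 7))"
proof (intro exI[of _ "1 / (4608 * 2187)"] conjI always_eventually allI impI)
  fix n s :: nat and c :: real and A :: random_stream_alg
  assume c: "1 \<le> c" "c < real n"
    and A: "approximates_clique_number n c A" "uses_space n s A"
  \<comment> \<open>As c >= 1, k <= 2c + 1 <= 3c, whence the factor 3^7 = 2187.\<close>
  define k where "k = nat \<lceil>2 * c\<rceil>"
  define r where "r = n div (2 * k ^ 3)"
  have k: "2 * c \<le> real k" "real k \<le> 3 * c"
    unfolding k_def using c by linarith+
  then have kpos: "k > 0" using c by (cases k) auto
  have k7: "real k ^ 7 \<le> 2187 * c ^ 7"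
    using power_mono[OF k(2), of 7] by (simp add: power_mult_distrib)
  have s: "1 \<le> real s"
    using space_pos[OF c A] by simp
  show "1 / (4608 * 2187) * ((real n)\<^sup>2 / c ^ 7) \<le> real s"
  proof (cases "r = 0")
    \<comment> \<open>The graph is too small for the construction, but then n^2 / c^7 is bounded by
      a constant and s >= 1 suffices.\<close>
    case True
    then have "n < 2 * k ^ 3"
      using kpos by (simp add: r_def div_eq_0_iff)
    then have "real n \<le> 2 * real k ^ 3"
      by (metis less_imp_le of_nat_le_iff of_nat_mult of_nat_numeral of_nat_power)
    then have "(real n)\<^sup>2 \<le> (2 * real k ^ 3)\<^sup>2"
      by (intro power_mono) auto
    also have "\<dots> = 4 * real k ^ 6"
      by (simp add: power_mult_distrib flip: power_mult)
    also have "\<dots> \<le> 4 * real k ^ 7"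
      using kpos by (intro mult_left_mono power_increasing) auto
    finally have "(real n)\<^sup>2 \<le> 4608 * 2187 * c ^ 7"
      using k7 zero_le_power[of c 7] c by linarith
    then have "1 / (4608 * 2187) * ((real n)\<^sup>2 / c ^ 7) \<le> 1"
      using c by (simp add: field_simps)
    with s show ?thesis by linarith
  next
    case False
    have "real (k * r\<^sup>2) \<le> 144 * (real k)\<^sup>2 * (real s + 1)"
      using False by (intro chain_space_lower_bound[OF c(1) k(1) _ _ A]) (auto simp: r_def)
    also have "\<dots> \<le> 144 * (real k)\<^sup>2 * (2 * real s)"
      using s by (intro mult_left_mono) auto
    finally have "real k * (real r)\<^sup>2 \<le> real k * (288 * real k * real s)"
      by (simp add: power2_eq_square algebra_simps)
    then have rs: "(real r)\<^sup>2 \<le> 288 * real k * real s"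
      using kpos by simp
    \<comment> \<open>Rounding in \<open>r\<close> costs a factor 2, since r + 1 <= 2r; after
      squaring, 16 * 288 = 4608.\<close>
    have "n < 2 * k ^ 3 * (r + 1)"
      unfolding r_def using kpos by (simp add: dividend_less_times_div)
    also have "\<dots> \<le> 4 * k ^ 3 * r"
      using False by (cases r) (auto simp: algebra_simps)
    finally have "real n \<le> 4 * real k ^ 3 * real r"
      by (metis less_imp_le of_nat_le_iff of_nat_mult of_nat_numeral of_nat_power)
    then have "(real n)\<^sup>2 \<le> (4 * real k ^ 3 * real r)\<^sup>2"
      by (intro power_mono) auto
    also have "\<dots> = 16 * real k ^ 6 * (real r)\<^sup>2"
      by (simp add: power_mult_distrib flip: power_mult)
    also have "\<dots> \<le> 16 * real k ^ 6 * (288 * real k * real s)"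
      using rs by (intro mult_left_mono) auto
    also have "\<dots> = 4608 * real s * real k ^ 7"
      by (simp add: eval_nat_numeral)
    also have "\<dots> \<le> 4608 * real s * (2187 * c ^ 7)"
      using k7 by (intro mult_left_mono) auto
    finally show ?thesis
      using c by (simp add: field_simps)
  qed
qed simp

end
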